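(* Every quadratic irrational real number $\alpha$ has an infinite order rational approximation $\mathcal{R}\subset\mathbb{Z}^2$ with denominators which grow at most exponentially.
   Context: A quadratic irrational is an irrational real number that is a root of a quadratic polynomial with integer coefficients. Definition. For $N\in\mathbb{N}$, an order $N$ rational approximation of $\alpha\in\mathbb{R}$ is an infinite subset $\mathcal{R}\subset\mathbb{Z}^2$ such that there exist real numbers $\gamma_1,\dots,\gamma_N$ for which \[ \frac{r}{s}=\alpha+\gamma_1 s^{-1}+\gamma_2 s^{-2}+\dots+\gamma_N s^{-N}+o\left([|r|+|s|]^{-N}\right) \] as $|r|+|s|\to\infty$ with $(r,s)\in\mathcal{R}$. (The condition is asymptotic; it presupposes $s\ne0$ for all but finitely many $(r,s)\in\mathcal{R}$.) An infinite order rational approximation of $\alpha$ is a subset $\mathcal{R}$ satisfying this condition for every $N\in\mathbb{N}$. The numbers $s$ with $(r,s)\in\mathcal{R}$ are the denominators. That they grow at most exponentially means that $\mathcal{R}$ can be enumerated without repetition as a sequence $(r_k,s_k)$, $k\in\mathbb{N}$, with $|s_k|=O(B^k)$ as $k\to\infty$ for some constant $B>1$. *)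

theory Defs
  imports
    Complex_Main
    "HOL-Computational_Algebra.Polynomial"
    "HOL-Library.Landau_Symbols"
begin

definition quadratic_irrational :: "real \<Rightarrow> bool" where
  "quadratic_irrational \<alpha> \<longleftrightarrow>
     \<alpha> \<notin> \<rat> \<and> (\<exists>p :: int poly. degree p = 2 \<and> poly (map_poly real_of_int p) \<alpha> = 0)"

text \<open>The filter of \<open>\<bar>r\<bar> + \<bar>s\<bar> \<rightarrow> \<infinity>\<close> with \<open>(r, s)\<close> ranging over \<open>R\<close>.\<close>

definition at_infinity_in :: "(int \<times> int) set \<Rightarrow> (int \<times> int) filter" where
  "at_infinity_in R = inf (filtercomap (\<lambda>(r, s). \<bar>r\<bar> + \<bar>s\<bar>) at_top) (principal R)"

text \<open>
  The finiteness condition makes explicit that the expansion presupposes \<open>s \<noteq> 0\<close> for all but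
  finitely many \<open>(r, s) \<in> R\<close>; it is needed because division by zero is total in HOL.
\<close>

definition rational_approximation :: "nat \<Rightarrow> real \<Rightarrow> (int \<times> int) set \<Rightarrow> bool" where
  "rational_approximation N \<alpha> R \<longleftrightarrow>
     infinite R \<and>
     finite {(r, s) \<in> R. s = 0} \<and>
     (\<exists>\<gamma> :: nat \<Rightarrow> real.
        (\<lambda>(r, s). real_of_int r / real_of_int s - (\<alpha> + (\<Sum>i = 1..N. \<gamma> i / real_of_int s ^ i)))
          \<in> o[at_infinity_in R](\<lambda>(r, s). 1 / real_of_int (\<bar>r\<bar> + \<bar>s\<bar>) ^ N))"

definition infinite_order_rational_approximation :: "real \<Rightarrow> (int \<times> int) set \<Rightarrow> bool" where
  "infinite_order_rational_approximation \<alpha> R \<longleftrightarrow> (\<forall>N. rational_approximation N \<alpha> R)"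

definition denominators_grow_at_most_exponentially :: "(int \<times> int) set \<Rightarrow> bool" where
  "denominators_grow_at_most_exponentially R \<longleftrightarrow>
     (\<exists>e :: nat \<Rightarrow> int \<times> int. bij_betw e UNIV R \<and>
        (\<exists>B :: real. B > 1 \<and> (\<lambda>k. real_of_int \<bar>snd (e k)\<bar>) \<in> O(\<lambda>k. B ^ k)))"

end

theory Submission
  imports Defs
    "HOL-Analysis.Generalised_Binomial_Theorem"
    "HOL-Analysis.Kronecker_Approximation_Theorem"
begin

text \<open>
  Write \<open>\<alpha> = (p + sqrt D) / q\<close> with integers \<open>p, q, D\<close>. If \<open>u\<^sup>2 - D v\<^sup>2 = 1\<close>, then
  \<open>(u / v)\<^sup>2 = D + 1 / v\<^sup>2\<close>, so with \<open>r = p v + u\<close> and \<open>s = q v\<close> the quotient \<open>r / s\<close> is exactly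
  \<open>g (1 / s)\<close>, where \<open>g t = (p + sqrt (D + q\<^sup>2 t\<^sup>2)) / q\<close> is analytic at \<open>0\<close> with \<open>g 0 = \<alpha>\<close>. Its
  Taylor coefficients serve as the \<open>\<gamma>\<^sub>i\<close> for all orders at once, and the powers of one nontrivial
  solution of Pell's equation supply denominators of exponential growth.
\<close>

section \<open>Pell's equation\<close>

text \<open>A zero would give \<open>sqrt D = \<bar>h / k\<bar>\<close>, a rational number.
  Nonvanishing lets the norm serve as a modulus and be cancelled.\<close>

lemma pell_form_nonzero:
  fixes D h k :: int
  assumes "sqrt D \<notin> \<rat>" "k > 0"
  shows "h\<^sup>2 - D * k\<^sup>2 \<noteq> 0"
proof
  assume "h\<^sup>2 - D * k\<^sup>2 = 0"
  then have "(real_of_int h)\<^sup>2 = D * (real_of_int k)\<^sup>2"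
    by (metis eq_iff_diff_eq_0 of_int_mult of_int_power)
  then have "sqrt D = sqrt ((h / k)\<^sup>2)"
    using \<open>k > 0\<close> by (simp add: power_divide)
  then have "sqrt D = \<bar>real_of_int h / real_of_int k\<bar>"
    by simp
  then show False
    using assms(1) by simp
qed

text \<open>The form factors as \<open>(h - k * sqrt D) * (h + k * sqrt D)\<close>. The first factor
  is at most \<open>1 / k\<close> in absolute value, while the second grows only linearly in
  \<open>k\<close>.\<close>

lemma approx_set_pell_form_bounded:
  fixes D h k :: int
  assumes "D > 0" "(h, k) \<in> approx_set (sqrt D)"
  shows "\<bar>h\<^sup>2 - D * k\<^sup>2\<bar> \<le> \<lceil>1 + 2 * sqrt D\<rceil>"
proof -
  have k: "k > 0" and approx: "\<bar>sqrt D - h / k\<bar> < 1 / (real_of_int k)\<^sup>2"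
    using assms(2) by (auto simp: approx_set_def)
  have "\<bar>h - k * sqrt D\<bar> = k * \<bar>sqrt D - h / k\<bar>"
    using k by (simp add: field_simps abs_if)
  also have "\<dots> \<le> k * (1 / (real_of_int k)\<^sup>2)"
    using k approx by (intro mult_left_mono) auto
  finally have diff: "\<bar>h - k * sqrt D\<bar> \<le> 1 / k"
    using k by (simp add: power2_eq_square)
  have "1 / real_of_int k \<le> 1"
    using k by simp
  moreover have "0 \<le> k * sqrt D"
    using k assms(1) by simp
  then have "\<bar>h + k * sqrt D\<bar> \<le> \<bar>h - k * sqrt D\<bar> + 2 * k * sqrt D"
    by linarith
  ultimately have add: "\<bar>h + k * sqrt D\<bar> \<le> 1 + 2 * k * sqrt D"
    using diff by linarith
  have "real_of_int \<bar>h\<^sup>2 - D * k\<^sup>2\<bar> = \<bar>h - k * sqrt D\<bar> * \<bar>h + k * sqrt D\<bar>"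
    using assms(1) by (simp add: abs_mult[symmetric] algebra_simps power2_eq_square)
  also have "\<dots> \<le> (1 / k) * (1 + 2 * k * sqrt D)"
    using diff add k by (intro mult_mono) auto
  also have "\<dots> \<le> 1 + 2 * sqrt D"
    using k by (simp add: field_simps)
  finally have "real_of_int \<bar>h\<^sup>2 - D * k\<^sup>2\<bar> \<le> 1 + 2 * sqrt D" .
  then show ?thesis
    by (metis ceiling_mono ceiling_of_int)
qed

text \<open>
  Lagrange's argument: two approximants \<open>h + k sqrt D\<close> of equal norm \<open>m\<close> that are congruent
  modulo \<open>m\<close> have as quotient a unit of norm \<open>1\<close>.
\<close>

lemma pell_solution_exists:
  fixes D :: int
  assumes "D > 0" "sqrt D \<notin> \<rat>"
  obtains u v :: int where "u > 0" "v > 0" "u\<^sup>2 - D * v\<^sup>2 = 1"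
proof -
  define A where "A = approx_set (sqrt D)"
  define M where "M = \<lceil>1 + 2 * sqrt D\<rceil>"
  define norm_form where "norm_form = (\<lambda>(h, k). h\<^sup>2 - D * k\<^sup>2 :: int)"
  \<comment> \<open>Equal values of \<open>f\<close> express what Lagrange's argument needs: the
    same norm, and congruence modulo it.\<close>
  define f where "f = (\<lambda>x. (norm_form x, fst x mod norm_form x, snd x mod norm_form x))"
  have "f ` A \<subseteq> {-M..M} \<times> {-M..M} \<times> {-M..M}"
  proof
    fix y assume "y \<in> f ` A"
    then obtain h k where hk: "(h, k) \<in> A" "y = f (h, k)"
      by auto
    have "k > 0"
      using hk(1) by (auto simp: A_def approx_set_def)
    \<comment> \<open>Since \<open>x mod 0 = x\<close>, the residues are bounded by the norm only
      because it is nonzero.\<close>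
    then have "norm_form (h, k) \<noteq> 0"
      using pell_form_nonzero[OF assms(2)] by (simp add: norm_form_def)
    moreover have "\<bar>norm_form (h, k)\<bar> \<le> M"
      using approx_set_pell_form_bounded[OF assms(1)] hk(1)
      by (simp add: norm_form_def M_def A_def)
    ultimately show "y \<in> {-M..M} \<times> {-M..M} \<times> {-M..M}"
      using abs_mod_less[of "norm_form (h, k)" h] abs_mod_less[of "norm_form (h, k)" k]
      by (auto simp: hk(2) f_def)
  qed
  then have "finite (f ` A)"
    by (rule finite_subset) simp
  \<comment> \<open>Irrationality of \<open>sqrt D\<close> supplies infinitely many approximants, so
    some fibre of \<open>f\<close> is infinite.\<close>
  moreover have "infinite A"
    using assms(2) rational_iff_finite_approx_set by (simp add: A_def)
  ultimately obtain x where "infinite {y \<in> A. f y = f x}"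
    using pigeonhole_infinite by blast
  then have inf: "{y \<in> A. f y = f x} - Z \<noteq> {}" if "finite Z" for Z
    using that Diff_infinite_finite infinite_imp_nonempty by blast
  obtain y where y: "y \<in> A" "f y = f x"
    using inf[of "{}"] by blast
  obtain z where z: "z \<in> A" "f z = f x" "z \<noteq> y"
    using inf[of "{y}"] by blast
  obtain h k h' k' where yz: "y = (h, k)" "z = (h', k')"
    by fastforce
  have pos: "k > 0" "k' > 0"
    using y z yz by (auto simp: A_def approx_set_def)
  define m where "m = h\<^sup>2 - D * k\<^sup>2"
  have "f (h, k) = f (h', k')"
    using y z yz by simp
  then have m': "m = h'\<^sup>2 - D * k'\<^sup>2" and mods: "h mod m = h' mod m" "k mod m = k' mod m"
    by (auto simp: f_def norm_form_def m_def)
  have "m \<noteq> 0"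
    using pell_form_nonzero[OF assms(2) pos(1)] by (simp add: m_def)
  \<comment> \<open>The quotient sought is \<open>(h' + k' * sqrt D) / (h + k * sqrt D)\<close>.
    Expanding it by \<open>h - k * sqrt D\<close> leaves the denominator \<open>m\<close>, which
    divides both coordinates of the new numerator; \<open>u\<close> and \<open>v\<close> are the
    results.\<close>
  have "(h * h' - D * (k * k')) mod m = (h * h - D * (k * k)) mod m"
    using mods by (intro mod_diff_cong mod_mult_cong) auto
  also have "\<dots> = 0"
    by (simp add: m_def power2_eq_square)
  finally obtain u where u: "h * h' - D * (k * k') = m * u"
    by auto
  have "(h * k' - h' * k) mod m = (h * k - h * k) mod m"
    using mods by (intro mod_diff_cong mod_mult_cong) auto
  then obtain v where v: "h * k' - h' * k = m * v"
    by auto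
  have "m\<^sup>2 * (u\<^sup>2 - D * v\<^sup>2) = (m * u)\<^sup>2 - D * (m * v)\<^sup>2"
    by (simp add: algebra_simps)
  \<comment> \<open>Brahmagupta's identity, the multiplicativity of the norm.\<close>
  also have "\<dots> = (h\<^sup>2 - D * k\<^sup>2) * (h'\<^sup>2 - D * k'\<^sup>2)"
    unfolding u[symmetric] v[symmetric] by algebra
  also have "\<dots> = m\<^sup>2 * 1"
    by (simp add: m_def[symmetric] m'[symmetric] power2_eq_square[of m])
  finally have norm1: "u\<^sup>2 - D * v\<^sup>2 = 1"
    using \<open>m \<noteq> 0\<close> by (simp only: mult_cancel_left) simp
  \<comment> \<open>If \<open>v = 0\<close>, the two pairs are proportional; equal norms then force
    \<open>k' = k\<close>, hence \<open>h' = h\<close>, against \<open>z \<noteq> y\<close>.\<close>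
  have "v \<noteq> 0"
  proof
    assume "v = 0"
    then have cross: "h * k' = h' * k"
      using v by simp
    have "m * k'\<^sup>2 = (h * k')\<^sup>2 - D * k\<^sup>2 * k'\<^sup>2"
      by (simp add: m_def algebra_simps)
    also have "\<dots> = m * k\<^sup>2"
      unfolding cross m' by (simp add: algebra_simps)
    finally have "k'\<^sup>2 = k\<^sup>2"
      using \<open>m \<noteq> 0\<close> by simp
    then have "k' = k"
      using pos by (simp add: power2_eq_iff)
    with cross pos yz z show False
      by simp
  qed
  moreover have "u \<noteq> 0"
  proof
    assume "u = 0"
    then have "D * v\<^sup>2 = -1"
      using norm1 by simp
    moreover have "D * v\<^sup>2 \<ge> 0"
      using assms(1) by simp
    ultimately show False by simp
  qed
  ultimately show thesis
    using norm1 that[of "\<bar>u\<bar>" "\<bar>v\<bar>"] by simp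
qed

text \<open>\<open>pell_power D u v k\<close> represents \<open>(u + v sqrt D) ^ (k + 1)\<close>.\<close>

primrec pell_power :: "int \<Rightarrow> int \<Rightarrow> int \<Rightarrow> nat \<Rightarrow> int \<times> int" where
  "pell_power D u v 0 = (u, v)"
| "pell_power D u v (Suc k) =
     (let (x, y) = pell_power D u v k in (u * x + D * (v * y), u * y + v * x))"

text \<open>The norm is multiplicative, so all powers of one solution are solutions. Positive
  coordinates make \<open>v\<close> strictly increasing, which later keeps the denominators
  distinct.\<close>

lemma pell_sequence_exists:
  fixes D :: int
  assumes "D > 0" "sqrt D \<notin> \<rat>"
  obtains u v :: "nat \<Rightarrow> int" and B :: real
  where "\<And>k. u k > 0" "\<And>k. v k > 0" "\<And>k. (u k)\<^sup>2 - D * (v k)\<^sup>2 = 1"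
    and "strict_mono v" "B > 1" "\<And>k. v k \<le> B ^ Suc k"
proof -
  obtain x y where xy: "x > 0" "y > 0" "x\<^sup>2 - D * y\<^sup>2 = 1"
    using pell_solution_exists[OF assms] .
  define u where "u k = fst (pell_power D x y k)" for k
  define v where "v k = snd (pell_power D x y k)" for k
  have zero: "u 0 = x" "v 0 = y"
    by (auto simp: u_def v_def)
  have step: "u (Suc k) = x * u k + D * (y * v k)" "v (Suc k) = x * v k + y * u k" for k
    by (auto simp: u_def v_def Let_def split: prod.splits)
  have pos: "u k > 0 \<and> v k > 0" for k
    by (induction k) (use xy assms in \<open>auto simp: zero step intro!: add_pos_pos mult_pos_pos\<close>)
  have norm: "(u k)\<^sup>2 - D * (v k)\<^sup>2 = 1" for k
  proof (induction k)
    case (Suc k)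
    have "(u (Suc k))\<^sup>2 - D * (v (Suc k))\<^sup>2 = (x\<^sup>2 - D * y\<^sup>2) * ((u k)\<^sup>2 - D * (v k)\<^sup>2)"
      unfolding step by algebra
    then show ?case
      using Suc.IH xy(3) by simp
  qed (use xy in \<open>simp add: zero\<close>)
  have "v k < v (Suc k)" for k
  proof -
    have "v k \<le> x * v k"
      using xy pos[of k] by simp
    moreover have "0 < y * u k"
      using xy pos[of k] by simp
    ultimately show ?thesis
      by (simp add: step)
  qed
  then have mono: "strict_mono v"
    by (simp add: strict_mono_Suc_iff)
  \<comment> \<open>\<open>B\<close> dominates \<open>x + y\<close> and \<open>x + D * y\<close>,
    the coefficients of \<open>u k\<close> and \<open>v k\<close> in
    \<open>u (Suc k) + v (Suc k)\<close>. The induction bounds this sum because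
    \<open>v (Suc k)\<close> also involves \<open>u k\<close>.\<close>
  define B where "B = x + (D + 1) * y"
  have "(D + 1) * y > 0"
    using xy assms by simp
  then have "B > 1"
    using xy by (simp add: B_def)
  have sum: "u k + v k \<le> B ^ Suc k" for k
  proof (induction k)
    case 0
    then show ?case
      using xy assms by (simp add: zero B_def algebra_simps)
  next
    case (Suc k)
    have "u (Suc k) + v (Suc k) = (x + y) * u k + (x + D * y) * v k"
      by (simp add: step algebra_simps)
    also have "\<dots> \<le> B * u k + B * v k"
      using xy assms pos[of k] by (intro add_mono mult_right_mono) (auto simp: B_def algebra_simps)
    also have "\<dots> = B * (u k + v k)"
      by (simp add: algebra_simps)
    also have "\<dots> \<le> B * B ^ Suc k"
      using Suc.IH \<open>B > 1\<close> by (intro mult_left_mono) auto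
    finally show ?case
      by simp
  qed
  have "v k \<le> B ^ Suc k" for k
    using sum[of k] pos[of k] by linarith
  then have "real_of_int (v k) \<le> real_of_int B ^ Suc k" for k
    by (metis of_int_le_iff of_int_power)
  with that[of u v "real_of_int B"] pos norm mono \<open>B > 1\<close> show thesis
    by auto
qed

section \<open>Expansions in powers of the reciprocal denominator\<close>

text \<open>Dividing the tail by \<open>x ^ Suc N\<close> leaves a power series \<open>h\<close>,
  which is continuous at \<open>0\<close> and hence bounded nearby.\<close>

lemma powser_remainder_bigo:
  fixes f :: "real \<Rightarrow> real"
  assumes "\<rho> > 0" and sums: "\<And>x. \<bar>x\<bar> < \<rho> \<Longrightarrow> (\<lambda>n. c n * x ^ n) sums f x"
  shows "(\<lambda>x. f x - (\<Sum>i\<le>N. c i * x ^ i)) \<in> O[at 0](\<lambda>x. x ^ Suc N)"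
proof -
  define h where "h x = (\<Sum>n. c (n + Suc N) * x ^ n)" for x
  have summ: "summable (\<lambda>n. c (n + Suc N) * x ^ n)" if "\<bar>x\<bar> < \<rho>" for x
    using sums_summable[OF sums[OF that]] summable_powser_ignore_initial_segment by blast
  have "isCont h 0"
    unfolding h_def using summ[of "\<rho> / 2"] assms(1) by (intro isCont_powser[where K = "\<rho> / 2"]) auto
  then have "h \<in> O[at 0](\<lambda>_. 1)"
    by (intro bigoI_tendsto[where c = "h 0"]) (auto simp: isCont_def)
  then have "(\<lambda>x. h x * x ^ Suc N) \<in> O[at 0](\<lambda>x. 1 * x ^ Suc N)"
    by (intro landau_o.big.mult_right)
  moreover have "\<forall>\<^sub>F x in at 0. f x - (\<Sum>i\<le>N. c i * x ^ i) = h x * x ^ Suc N"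
  proof -
    have "\<forall>\<^sub>F x in at 0. \<bar>x\<bar> < \<rho>"
      using assms(1) by (auto simp: eventually_at dist_real_def)
    then show ?thesis
    proof eventually_elim
      case (elim x)
      have "(\<lambda>n. c (n + Suc N) * x ^ (n + Suc N)) sums (f x - (\<Sum>i\<le>N. c i * x ^ i))"
        using sums_split_initial_segment[OF sums[OF elim], of "Suc N"]
        by (simp only: lessThan_Suc_atMost)
      moreover have "(\<lambda>n. c (n + Suc N) * x ^ n * x ^ Suc N) sums (h x * x ^ Suc N)"
        unfolding h_def by (intro sums_mult2 summable_sums summ elim)
      ultimately show ?case
        by (simp only: power_add mult.assoc) (rule sums_unique2)
    qed
  qed
  ultimately show ?thesis
    by (subst landau_o.big.in_cong) simp_all
qed

text \<open>The binomial series of \<open>sqrt (D + y)\<close> is taken at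
  \<open>y = q\<^sup>2 * x\<^sup>2\<close>. It converges for \<open>y < D\<close>, whence the radius
  \<open>sqrt D / \<bar>q\<bar>\<close>.\<close>

lemma sqrt_quadratic_powser:
  fixes D p q :: real
  assumes "D > 0" "q \<noteq> 0"
  obtains c :: "nat \<Rightarrow> real" and \<rho> :: real
  where "\<rho> > 0" "\<And>x. \<bar>x\<bar> < \<rho> \<Longrightarrow> (\<lambda>n. c n * x ^ n) sums ((p + sqrt (D + q\<^sup>2 * x\<^sup>2)) / q)"
proof -
  define a where "a n = ((1/2) gchoose n) * D powr (1/2 - real n) * (q\<^sup>2) ^ n" for n
  \<comment> \<open>\<open>p\<close> enters only the constant term; the binomial coefficients occupy
    the even positions.\<close>
  define c where "c n = ((if n = 0 then p else 0) + (if even n then a (n div 2) else 0)) / q" for n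
  define \<rho> where "\<rho> = sqrt D / \<bar>q\<bar>"
  have "(\<lambda>n. c n * x ^ n) sums ((p + sqrt (D + q\<^sup>2 * x\<^sup>2)) / q)" if x: "\<bar>x\<bar> < \<rho>" for x
  proof -
    have "\<bar>q * x\<bar> < sqrt D"
      using x assms by (simp add: \<rho>_def field_simps abs_mult)
    then have "(q * x)\<^sup>2 < D"
      using real_less_rsqrt real_sqrt_abs real_sqrt_less_iff by metis
    then have "(\<lambda>n. ((1/2) gchoose n) * D powr (1/2 - real n) * (q\<^sup>2 * x\<^sup>2) ^ n) sums
        sqrt (D + q\<^sup>2 * x\<^sup>2)"
      by (intro sqrt_series') (simp add: power_mult_distrib)
    then have "(\<lambda>n. a n * (x\<^sup>2) ^ n) sums sqrt (D + q\<^sup>2 * x\<^sup>2)"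
      by (simp add: a_def power_mult_distrib mult.assoc)
    \<comment> \<open>Interleaving with the zero series turns a series in \<open>x\<^sup>2\<close>
      into one in \<open>x\<close>.\<close>
    from sums_if[OF sums_zero this]
    have "(\<lambda>n. if even n then a (n div 2) * (x\<^sup>2) ^ (n div 2) else 0) sums sqrt (D + q\<^sup>2 * x\<^sup>2)"
      by simp
    also have "(\<lambda>n. if even n then a (n div 2) * (x\<^sup>2) ^ (n div 2) else 0) =
        (\<lambda>n. (if even n then a (n div 2) else 0) * x ^ n)"
      by (auto simp: power_mult[symmetric])
    finally have even: "(\<lambda>n. (if even n then a (n div 2) else 0) * x ^ n) sums
        sqrt (D + q\<^sup>2 * x\<^sup>2)" .
    have "(\<lambda>n. (if n = 0 then p else 0) * x ^ n) sums p"
      using sums_single[of 0 "\<lambda>n. p * x ^ n"]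
      by (simp add: if_distrib[of "\<lambda>y. y * _"] cong: if_cong)
    from sums_add[OF this even]
    have "(\<lambda>n. (if n = 0 then p else 0) * x ^ n + (if even n then a (n div 2) else 0) * x ^ n)
        sums (p + sqrt (D + q\<^sup>2 * x\<^sup>2))" .
    from sums_divide[OF this, of q] show ?thesis
      by (simp add: c_def algebra_simps add_divide_distrib)
  qed
  moreover have "\<rho> > 0"
    using assms by (simp add: \<rho>_def)
  ultimately show thesis
    using that by blast
qed

text \<open>The bound makes \<open>\<bar>s\<bar>\<close> comparable to
  \<open>\<bar>r\<bar> + \<bar>s\<bar>\<close>, so it tends to infinity along \<open>R\<close>. The
  target is the punctured filter \<open>at 0\<close>, ready for composition with
  \<open>powser_remainder_bigo\<close>.\<close>

lemma filterlim_inverse_denominator: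
  fixes C :: real
  assumes "\<And>r s. (r, s) \<in> R \<Longrightarrow> s \<noteq> 0 \<and> real_of_int (\<bar>r\<bar> + \<bar>s\<bar>) \<le> C * real_of_int \<bar>s\<bar>" and "C > 0"
  shows "filterlim (\<lambda>(r, s). 1 / real_of_int s) (at 0) (at_infinity_in R)"
proof -
  have "filterlim (\<lambda>(r, s). real_of_int s) at_infinity (at_infinity_in R)"
    unfolding filterlim_at_infinity_conv_norm_at_top filterlim_at_top
  proof
    fix Z :: real
    have "Z \<le> \<bar>real_of_int s\<bar>" if "(r, s) \<in> R" "\<bar>r\<bar> + \<bar>s\<bar> \<ge> \<lceil>C * Z\<rceil>" for r s
    proof -
      have "C * Z \<le> real_of_int (\<bar>r\<bar> + \<bar>s\<bar>)"
        using that(2) by linarith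
      also have "\<dots> \<le> C * \<bar>real_of_int s\<bar>"
        using assms(1)[OF that(1)] by simp
      finally show ?thesis
        using assms(2) by simp
    qed
    then show "\<forall>\<^sub>F x in at_infinity_in R. Z \<le> norm (case x of (r, s) \<Rightarrow> real_of_int s)"
      unfolding at_infinity_in_def eventually_inf_principal eventually_filtercomap_at_top_linorder
      by (intro exI[of _ "\<lceil>C * Z\<rceil>"]) auto
  qed
  then show ?thesis
    by (simp add: case_prod_unfold inverse_eq_divide[symmetric] filterlim_inverse_at_iff)
qed

text \<open>The coefficients \<open>c i\<close> serve as \<open>\<gamma> i\<close> for every
  \<open>N\<close>. Truncation after degree \<open>N\<close> leaves an error of order
  \<open>(1 / s) ^ Suc N\<close>, which is \<open>o\<close> of \<open>(1 / s) ^ N\<close>; the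
  linear bound then replaces \<open>s\<close> by
  \<open>\<bar>r\<bar> + \<bar>s\<bar>\<close>.\<close>

lemma infinite_order_approximation_of_powser:
  fixes g :: "real \<Rightarrow> real" and c :: "nat \<Rightarrow> real" and C :: real
  assumes "infinite R"
    and R: "\<And>r s. (r, s) \<in> R \<Longrightarrow> s \<noteq> 0 \<and> real_of_int (\<bar>r\<bar> + \<bar>s\<bar>) \<le> C * real_of_int \<bar>s\<bar>"
    and g: "\<And>r s. (r, s) \<in> R \<Longrightarrow> real_of_int r / real_of_int s = g (1 / s)"
    and "\<rho> > 0" "\<And>x. \<bar>x\<bar> < \<rho> \<Longrightarrow> (\<lambda>n. c n * x ^ n) sums g x"
  shows "infinite_order_rational_approximation (g 0) R"
  unfolding infinite_order_rational_approximation_def rational_approximation_def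
proof (intro allI conjI exI)
  fix N :: nat
  let ?F = "at_infinity_in R"
  \<comment> \<open>Positivity of \<open>C\<close> follows from the bound at any single element of
    \<open>R\<close>.\<close>
  have "R \<noteq> {}"
    using assms(1) by auto
  then obtain r0 s0 where "(r0, s0) \<in> R"
    by auto
  with R have "s0 \<noteq> 0" "real_of_int (\<bar>r0\<bar> + \<bar>s0\<bar>) \<le> C * real_of_int \<bar>s0\<bar>"
    by auto
  then have "0 < C * real_of_int \<bar>s0\<bar>"
    by (elim less_le_trans[rotated]) simp
  then have "C > 0"
    by (simp add: zero_less_mult_iff)
  have "(\<lambda>n. c n * 0 ^ n) sums c 0"
    by (rule powser_sums_zero)
  then have c0: "c 0 = g 0"
    using assms(5)[of 0] \<open>\<rho> > 0\<close> sums_unique2 by fastforce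
  have lim: "filterlim (\<lambda>(r, s). 1 / real_of_int s) (at 0) ?F"
    using filterlim_inverse_denominator[OF R \<open>C > 0\<close>] .
  have ev: "\<forall>\<^sub>F x in ?F. x \<in> R"
    by (simp add: at_infinity_in_def eventually_inf_principal)
  have "(\<lambda>(r, s). real_of_int r / real_of_int s - (g 0 + (\<Sum>i = 1..N. c i / real_of_int s ^ i))) \<in>
      O[?F](\<lambda>(r, s). (1 / real_of_int s) ^ Suc N)"
  proof -
    have "(\<lambda>x. g (case x of (r, s) \<Rightarrow> 1 / real_of_int s) -
        (\<Sum>i\<le>N. c i * (case x of (r, s) \<Rightarrow> 1 / real_of_int s) ^ i)) \<in>
        O[?F](\<lambda>x. (case x of (r, s) \<Rightarrow> 1 / real_of_int s) ^ Suc N)"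
      by (rule landau_o.big.compose[OF powser_remainder_bigo[OF assms(4,5)] lim])
    moreover have "\<forall>\<^sub>F x in ?F. g (case x of (r, s) \<Rightarrow> 1 / real_of_int s) -
        (\<Sum>i\<le>N. c i * (case x of (r, s) \<Rightarrow> 1 / real_of_int s) ^ i) =
        (case x of (r, s) \<Rightarrow>
          real_of_int r / real_of_int s - (g 0 + (\<Sum>i = 1..N. c i / real_of_int s ^ i)))"
      using ev
      by eventually_elim
        (auto simp: g c0 atMost_atLeast0 sum.atLeast_Suc_atMost power_divide)
    ultimately show ?thesis
      by (simp add: case_prod_unfold landau_o.big.in_cong)
  qed
  also have "(\<lambda>(r, s). (1 / real_of_int s) ^ Suc N) \<in> o[?F](\<lambda>(r, s). (1 / real_of_int s) ^ N)"
  proof -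
    have "((\<lambda>(r, s). 1 / real_of_int s) \<longlongrightarrow> 0) ?F"
      using lim by (simp add: filterlim_at)
    then have "(\<lambda>(r, s). 1 / real_of_int s) \<in> o[?F](\<lambda>_. 1)"
      by (intro smalloI_tendsto) simp_all
    from landau_o.small.mult_right[OF this, of "\<lambda>(r, s). (1 / real_of_int s) ^ N"]
    show ?thesis
      by (simp add: case_prod_unfold)
  qed
  also have "(\<lambda>(r, s). (1 / real_of_int s) ^ N) \<in> O[?F](\<lambda>(r, s). 1 / real_of_int (\<bar>r\<bar> + \<bar>s\<bar>) ^ N)"
  proof (rule landau_o.bigI[of "C ^ N"])
    show "\<forall>\<^sub>F x in ?F. norm (case x of (r, s) \<Rightarrow> (1 / real_of_int s) ^ N) \<le>
        C ^ N * norm (case x of (r, s) \<Rightarrow> 1 / real_of_int (\<bar>r\<bar> + \<bar>s\<bar>) ^ N)"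
      using ev
    proof eventually_elim
      case (elim x)
      obtain r s where x: "x = (r, s)"
        by fastforce
      with R elim have rs: "s \<noteq> 0" "real_of_int (\<bar>r\<bar> + \<bar>s\<bar>) \<le> C * real_of_int \<bar>s\<bar>"
        by auto
      define t where "t = real_of_int (\<bar>r\<bar> + \<bar>s\<bar>)"
      have "t > 0"
        using rs(1) by (simp add: t_def)
      then have "\<bar>1 / real_of_int s\<bar> \<le> C * (1 / t)"
        using rs[folded t_def] by (simp add: field_simps)
      then have "\<bar>1 / real_of_int s\<bar> ^ N \<le> (C * (1 / t)) ^ N"
        by (rule power_mono) simp
      then show ?case
        using \<open>t > 0\<close>
          by (simp add: x t_def[symmetric] power_abs power_mult_distrib power_divide del: of_int_add)
    qed
  qed (use \<open>C > 0\<close> in simp)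
  finally show "(\<lambda>(r, s). real_of_int r / real_of_int s - (g 0 + (\<Sum>i = 1..N. c i / real_of_int s ^ i))) \<in>
      o[?F](\<lambda>(r, s). 1 / real_of_int (\<bar>r\<bar> + \<bar>s\<bar>) ^ N)" .
  have "{(r, s) \<in> R. s = 0} = {}"
    using R by auto
  then show "finite {(r, s) \<in> R. s = 0}"
    by (simp only: finite.emptyI)
qed (rule assms(1))

section \<open>Quadratic irrationals\<close>

text \<open>Completing the square shows that \<open>\<delta> = 2 * a * \<alpha> + b\<close> is a
  square root of the discriminant \<open>D\<close>; its irrationality is inherited from
  \<open>\<alpha>\<close>.\<close>

lemma quadratic_irrationalE:
  assumes "quadratic_irrational \<alpha>"
  obtains p q D :: int where "q \<noteq> 0" "D > 0" "sqrt D \<notin> \<rat>" "\<alpha> = (p + sqrt D) / q"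
proof -
  obtain P :: "int poly" where P: "degree P = 2" "poly (map_poly real_of_int P) \<alpha> = 0"
    and irrat: "\<alpha> \<notin> \<rat>"
    using assms by (auto simp: quadratic_irrational_def)
  define a b c where "a = coeff P 2" and "b = coeff P 1" and "c = coeff P 0"
  have "a \<noteq> 0"
    using P(1) by (metis a_def degree_0 leading_coeff_0_iff zero_neq_numeral)
  have root: "a * \<alpha>\<^sup>2 + b * \<alpha> + c = 0"
    using P by (simp add: poly_altdef degree_map_poly coeff_map_poly a_def b_def c_def
      numeral_2_eq_2 algebra_simps)
  define D where "D = b\<^sup>2 - 4 * a * c"
  define \<delta> where "\<delta> = 2 * a * \<alpha> + b"
  have "\<delta>\<^sup>2 - D = 4 * a * (a * \<alpha>\<^sup>2 + b * \<alpha> + c)"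
    unfolding \<delta>_def D_def by (simp add: algebra_simps power2_eq_square)
  then have D: "\<delta>\<^sup>2 = D"
    by (simp add: root)
  have \<alpha>: "\<alpha> = (\<delta> - b) / (2 * a)"
    using \<open>a \<noteq> 0\<close> by (simp add: \<delta>_def)
  have "\<delta> \<notin> \<rat>"
    using irrat \<alpha> by (metis Rats_diff Rats_divide Rats_mult Rats_number_of Rats_of_int)
  then have "\<delta> \<noteq> 0"
    by auto
  then have "real_of_int D > 0"
    using D by (metis zero_less_power2)
  then have "D > 0"
    by simp
  have abs: "sqrt D = \<bar>\<delta>\<bar>"
    using D by (metis real_sqrt_abs)
  then have irr: "sqrt D \<notin> \<rat>"
    using \<open>\<delta> \<notin> \<rat>\<close> by simp
  show thesis
  \<comment> \<open>When \<open>\<delta>\<close> is the negative root, negating numerator and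
    denominator brings \<open>sqrt D\<close> in with a plus sign.\<close>
  proof (cases "\<delta> > 0")
    case True
    then show thesis
      using that[of "2 * a" D "- b"] \<open>a \<noteq> 0\<close> \<open>D > 0\<close> irr \<alpha> abs by simp
  next
    case False
    have "\<alpha> = (b + sqrt D) / (- 2 * a)"
      using False abs \<alpha> \<open>a \<noteq> 0\<close> by (simp add: field_simps)
    then show thesis
      using that[of "- 2 * a" D b] \<open>a \<noteq> 0\<close> \<open>D > 0\<close> irr by simp
  qed
qed

theorem theorem4p3:
  fixes \<alpha> :: real
  assumes "quadratic_irrational \<alpha>"
  shows "\<exists>R :: (int \<times> int) set.
           infinite_order_rational_approximation \<alpha> R \<and> denominators_grow_at_most_exponentially R"
proof -
  obtain p q D :: int where q: "q \<noteq> 0" and D: "D > 0" "sqrt D \<notin> \<rat>"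
    and \<alpha>: "\<alpha> = (p + sqrt D) / q"
    using quadratic_irrationalE[OF assms] .
  obtain u v :: "nat \<Rightarrow> int" and B :: real
    where pos: "\<And>k. u k > 0" "\<And>k. v k > 0" and norm: "\<And>k. (u k)\<^sup>2 - D * (v k)\<^sup>2 = 1"
      and mono: "strict_mono v" and B: "B > 1" "\<And>k. v k \<le> B ^ Suc k"
    by (rule pell_sequence_exists[OF D]) blast
  define e where "e k = (p * v k + u k, q * v k)" for k
  define R where "R = range e"
  define g where "g x = (p + sqrt (D + (real_of_int q)\<^sup>2 * x\<^sup>2)) / q" for x
  \<comment> \<open>The second coordinates alone are distinct, as \<open>v\<close> is strictly
    increasing and \<open>q \<noteq> 0\<close>.\<close>
  have "inj e"
    using strict_mono_eq[OF mono] q by (auto simp: inj_def e_def)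
  then have "infinite R"
    using finite_imageD infinite_UNIV_nat unfolding R_def by blast
  obtain c \<rho> where c: "\<rho> > 0" "\<And>x. \<bar>x\<bar> < \<rho> \<Longrightarrow> (\<lambda>n. c n * x ^ n) sums g x"
    unfolding g_def by (rule sqrt_quadratic_powser[of D q p]) (use q D in auto)
  have quot: "real_of_int r / real_of_int s = g (1 / s)" if rs: "(r, s) \<in> R" for r s
  proof -
    obtain k where k: "r = p * v k + u k" "s = q * v k"
      using rs by (auto simp: R_def e_def)
    have "(real_of_int (u k))\<^sup>2 = D * (real_of_int (v k))\<^sup>2 + 1"
      using norm[of k] by (metis add.commute diff_eq_eq of_int_1 of_int_add of_int_mult of_int_power)
    \<comment> \<open>With \<open>s = q * v k\<close>, the left-hand side is the radicand in
      \<open>g (1 / s)\<close>, so that root is the rational number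
      \<open>u k / v k\<close>.\<close>
    then have "D + 1 / (real_of_int (v k))\<^sup>2 = (u k / v k)\<^sup>2"
      using pos(2)[of k] by (simp add: field_simps)
    then have "sqrt (D + 1 / (real_of_int (v k))\<^sup>2) = u k / v k"
      using pos[of k] by simp
    then show ?thesis
      using q pos(2)[of k] by (simp add: g_def k field_simps)
  qed
  \<comment> \<open>Relative to \<open>v k\<close>, the summand \<open>\<bar>p\<bar> + D + 1\<close>
    bounds \<open>\<bar>r\<bar>\<close>, using \<open>u k \<le> (D + 1) * v k\<close>, and
    \<open>\<bar>q\<bar>\<close> accounts for \<open>\<bar>s\<bar>\<close>.\<close>
  define C where "C = \<bar>p\<bar> + D + 1 + \<bar>q\<bar>"
  have bound: "s \<noteq> 0 \<and> real_of_int (\<bar>r\<bar> + \<bar>s\<bar>) \<le> real_of_int C * real_of_int \<bar>s\<bar>" if rs: "(r, s) \<in> R" for r s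
  proof -
    obtain k where k: "r = p * v k + u k" "s = q * v k"
      using rs by (auto simp: R_def e_def)
    have "(u k)\<^sup>2 \<le> ((D + 1) * v k)\<^sup>2"
    proof -
      have "1 \<le> (v k)\<^sup>2"
        using pos(2)[of k] by (simp add: int_one_le_iff_zero_less)
      then have "(u k)\<^sup>2 \<le> (D + 1) * (v k)\<^sup>2"
        using norm[of k] by (simp add: algebra_simps)
      also have "\<dots> \<le> (D + 1)\<^sup>2 * (v k)\<^sup>2"
        using D(1) by (intro mult_right_mono) (auto simp: power2_eq_square)
      finally show ?thesis
        by (simp add: power_mult_distrib)
    qed
    then have "u k \<le> (D + 1) * v k"
      by (rule power2_le_imp_le) (use D(1) pos(2)[of k] in simp)
    moreover have "\<bar>r\<bar> \<le> \<bar>p\<bar> * v k + u k"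
      using pos[of k] abs_triangle_ineq[of "p * v k" "u k"] by (simp add: k abs_mult)
    moreover have "\<bar>s\<bar> = \<bar>q\<bar> * v k"
      using pos(2)[of k] by (simp add: k abs_mult)
    ultimately have "\<bar>r\<bar> + \<bar>s\<bar> \<le> C * v k"
      by (simp add: C_def algebra_simps)
    \<comment> \<open>Here \<open>v k \<le> \<bar>s\<bar>\<close>, because the nonzero integer
      \<open>q\<close> has absolute value at least \<open>1\<close>.\<close>
    also have "\<dots> \<le> C * \<bar>s\<bar>"
      using q pos(2)[of k] D(1) by (intro mult_left_mono) (auto simp: k abs_mult C_def)
    finally have "real_of_int (\<bar>r\<bar> + \<bar>s\<bar>) \<le> real_of_int (C * \<bar>s\<bar>)"
      by (simp only: of_int_le_iff)
    moreover have "s \<noteq> 0"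
      using q pos(2)[of k] by (simp add: k)
    ultimately show ?thesis
      by simp
  qed
  have "g 0 = \<alpha>"
    by (simp add: g_def \<alpha>)
  then have "infinite_order_rational_approximation \<alpha> R"
    using infinite_order_approximation_of_powser[OF \<open>infinite R\<close> bound quot c] by simp
  moreover have "denominators_grow_at_most_exponentially R"
    unfolding denominators_grow_at_most_exponentially_def
  proof (intro exI conjI)
    show "bij_betw e UNIV R"
      using \<open>inj e\<close> by (simp add: R_def inj_on_imp_bij_betw)
    \<comment> \<open>The constant \<open>\<bar>q\<bar> * B\<close> contains one factor
      \<open>B\<close> to absorb the exponent \<open>Suc k\<close> in the bound on
      \<open>v k\<close>.\<close>
    show "(\<lambda>k. real_of_int \<bar>snd (e k)\<bar>) \<in> O(\<lambda>k. B ^ k)"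
    proof (rule bigoI[of _ "\<bar>q\<bar> * B"], rule always_eventually, rule allI)
      fix k
      have "real_of_int \<bar>snd (e k)\<bar> = real_of_int \<bar>q\<bar> * v k"
        using pos(2)[of k] by (simp add: e_def abs_mult)
      also have "\<dots> \<le> real_of_int \<bar>q\<bar> * B ^ Suc k"
        using B(2)[of k] by (intro mult_left_mono) auto
      finally show "norm (real_of_int \<bar>snd (e k)\<bar>) \<le> \<bar>q\<bar> * B * norm (B ^ k)"
        using B(1) by (simp add: mult.assoc)
    qed
  qed (rule B(1))
  ultimately show ?thesis
    by blast
qed

end
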